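(* For each nonzero $g\in \{(2k+1)^2:k\in\mathbb{Z}\}\cup\{2m^2:m\in\mathbb{Z}\}$, there are infinitely many primitive Pythagorean triples of the form $(a,b,b+g)$.
   Context: A Pythagorean triple is a triple of integers $(a,b,c)\in\mathbb{Z}^3$ such that $a^2+b^2=c^2$. It is a primitive Pythagorean triple if the only integer $d>0$ dividing all of $a$, $b$ and $c$ is $d=1$. *)

theory Defs
  imports Main
begin

definition pythagorean_triple :: "int \<times> int \<times> int \<Rightarrow> bool" where
  "pythagorean_triple = (\<lambda>(a, b, c). a\<^sup>2 + b\<^sup>2 = c\<^sup>2)"

definition primitive_pythagorean_triple :: "int \<times> int \<times> int \<Rightarrow> bool" where
  "primitive_pythagorean_triple = (\<lambda>(a, b, c).
     pythagorean_triple (a, b, c) \<and>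
     (\<forall>d > 0. d dvd a \<and> d dvd b \<and> d dvd c \<longrightarrow> d = 1))"

end

theory Submission
  imports Defs
begin

text \<open>
  Euclid's parametrization makes the triple with legs \<open>u\<^sup>2 - v\<^sup>2\<close> and \<open>2uv\<close> and hypotenuse
  \<open>u\<^sup>2 + v\<^sup>2\<close> primitive whenever \<open>u\<close> and \<open>v\<close> are coprime and of opposite parity. The difference
  between the hypotenuse and the second entry is \<open>(u - v)\<^sup>2\<close> or \<open>2v\<^sup>2\<close>, depending on which leg is
  put second. So an odd square \<open>r\<^sup>2\<close> is realized by fixing \<open>u - v = r\<close>, and \<open>2m\<^sup>2\<close> by fixing
  \<open>v = m\<close>. In both cases one parameter is still free, and letting it run through a suitable
  arithmetic progression keeps \<open>u\<close> and \<open>v\<close> coprime and of opposite parity. The first leg is then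
  a nonconstant linear function of the index in the progression, because \<open>r\<close> and \<open>m\<close> are nonzero,
  so the triples are pairwise distinct.
\<close>

text \<open>
  A common divisor of the entries divides \<open>2u\<^sup>2\<close> and \<open>2v\<^sup>2\<close>, the sum and the difference of
  \<open>u\<^sup>2 + v\<^sup>2\<close> and \<open>u\<^sup>2 - v\<^sup>2\<close>. It is odd, since \<open>u\<^sup>2 + v\<^sup>2\<close> is, so it divides the coprime
  numbers \<open>u\<^sup>2\<close> and \<open>v\<^sup>2\<close>.
\<close>
lemma primitive_pythagorean_triple_Euclid:
  fixes u v :: int
  assumes "coprime u v" and "odd (u + v)"
  shows "primitive_pythagorean_triple (u\<^sup>2 - v\<^sup>2, 2 * u * v, u\<^sup>2 + v\<^sup>2)"
proof -
  have "(u\<^sup>2 - v\<^sup>2)\<^sup>2 + (2 * u * v)\<^sup>2 = (u\<^sup>2 + v\<^sup>2)\<^sup>2"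
    by (simp add: power2_eq_square algebra_simps)
  moreover have "d = 1"
    if "d > 0" and diff: "d dvd u\<^sup>2 - v\<^sup>2" and sum: "d dvd u\<^sup>2 + v\<^sup>2" for d
  proof -
    have "odd (u\<^sup>2 + v\<^sup>2)"
      using assms(2) by simp
    with sum have "odd d"
      using dvd_trans by blast
    then have "coprime d 2"
      by simp
    moreover have "d dvd 2 * u\<^sup>2" "d dvd 2 * v\<^sup>2"
      using dvd_add[OF sum diff] dvd_diff[OF sum diff] by simp_all
    ultimately have "d dvd u\<^sup>2" "d dvd v\<^sup>2"
      by (simp_all add: coprime_dvd_mult_right_iff)
    moreover have "coprime (u\<^sup>2) (v\<^sup>2)"
      using assms(1) by simp
    ultimately have "is_unit d"
      using coprime_common_divisor by blast
    with \<open>d > 0\<close> show ?thesis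
      by simp
  qed
  ultimately show ?thesis
    by (auto simp: primitive_pythagorean_triple_def pythagorean_triple_def)
qed

lemma primitive_pythagorean_triple_swap_legs:
  assumes "primitive_pythagorean_triple (a, b, c)"
  shows "primitive_pythagorean_triple (b, a, c)"
  using assms by (auto simp: primitive_pythagorean_triple_def pythagorean_triple_def add.commute)

lemma infinite_triples_if_inj:
  fixes a b c :: "int \<Rightarrow> int"
  assumes "inj a" and "\<And>t. P (a t, b t, c t)" and "\<And>t. c t = b t + g"
  shows "infinite {(a, b, c). P (a, b, c) \<and> c = b + g}"
proof (rule infinite_super)
  show "range (\<lambda>t. (a t, b t, c t)) \<subseteq> {(a, b, c). P (a, b, c) \<and> c = b + g}"
    using assms(2,3) by auto
  have "inj (\<lambda>t. (a t, b t, c t))"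
    using assms(1) by (auto simp: inj_def)
  then show "infinite (range (\<lambda>t. (a t, b t, c t)))"
    using finite_imageD infinite_UNIV_int by blast
qed

text \<open>
  The progression \<open>v \<equiv> 1 (mod r)\<close> makes \<open>v\<close> and \<open>u = v + r\<close> coprime. Their parities differ
  because \<open>r\<close> is odd.
\<close>
lemma infinite_primitive_triples_odd_square:
  fixes r :: int
  assumes "odd r"
  shows "infinite {(a, b, c). primitive_pythagorean_triple (a, b, c) \<and> c = b + r\<^sup>2}"
proof (rule infinite_triples_if_inj)
  define v where "v t = r * t + 1" for t
  define u where "u t = v t + r" for t
  have "r \<noteq> 0"
    using assms by auto
  moreover have "(u t)\<^sup>2 - (v t)\<^sup>2 = r * (2 * r * t + 2 + r)" for t
    by (simp add: u_def v_def power2_eq_square algebra_simps)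
  ultimately show "inj (\<lambda>t. (u t)\<^sup>2 - (v t)\<^sup>2)"
    by (simp add: inj_def)
  show "primitive_pythagorean_triple ((u t)\<^sup>2 - (v t)\<^sup>2, 2 * u t * v t, (u t)\<^sup>2 + (v t)\<^sup>2)" for t
  proof (rule primitive_pythagorean_triple_Euclid)
    have "coprime r (v t)"
      using dvd_add_right_iff[of _ "r * t" 1] unfolding v_def by (intro coprimeI) auto
    then show "coprime (u t) (v t)"
      unfolding u_def by (metis coprime_iff_gcd_eq_1 gcd_add1 gcd.commute add.commute)
    show "odd (u t + v t)"
      using assms by (simp add: u_def)
  qed
  show "(u t)\<^sup>2 + (v t)\<^sup>2 = 2 * u t * v t + r\<^sup>2" for t
    by (simp add: u_def power2_eq_square algebra_simps)
qed

text \<open>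
  The progression \<open>u \<equiv> m + 1 (mod 2m)\<close> gives both \<open>u \<equiv> 1 (mod m)\<close>, hence coprimality with
  \<open>v = m\<close>, and the parity opposite to that of \<open>m\<close>.
\<close>
lemma infinite_primitive_triples_double_square:
  fixes m :: int
  assumes "m \<noteq> 0"
  shows "infinite {(a, b, c). primitive_pythagorean_triple (a, b, c) \<and> c = b + 2 * m\<^sup>2}"
proof (rule infinite_triples_if_inj)
  define u where "u t = 2 * m * t + m + 1" for t
  show "inj (\<lambda>t. 2 * u t * m)"
    using assms by (simp add: inj_def u_def)
  show "primitive_pythagorean_triple (2 * u t * m, (u t)\<^sup>2 - m\<^sup>2, (u t)\<^sup>2 + m\<^sup>2)" for t
  proof (rule primitive_pythagorean_triple_swap_legs, rule primitive_pythagorean_triple_Euclid)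
    have "u t = m * (2 * t + 1) + 1"
      by (simp add: u_def algebra_simps)
    then show "coprime (u t) m"
      using dvd_add_right_iff[of _ "m * (2 * t + 1)" 1] by (intro coprimeI) auto
    show "odd (u t + m)"
      by (simp add: u_def)
  qed
  show "(u t)\<^sup>2 + m\<^sup>2 = (u t)\<^sup>2 - m\<^sup>2 + 2 * m\<^sup>2" for t
    by simp
qed

theorem theorem2p4:
  fixes g :: int
  assumes "g \<in> {(2 * k + 1)\<^sup>2 | k :: int. True} \<union> {2 * m\<^sup>2 | m :: int. True}"
    and "g \<noteq> 0"
  shows "infinite {(a, b, c). primitive_pythagorean_triple (a, b, c) \<and> c = b + g}"
proof -
  consider k where "g = (2 * k + 1)\<^sup>2" | m where "g = 2 * m\<^sup>2"
    using assms(1) by blast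
  then show ?thesis
  proof cases
    case 1
    then show ?thesis
      using infinite_primitive_triples_odd_square[of "2 * k + 1"] by simp
  next
    case 2
    with assms(2) have "m \<noteq> 0"
      by auto
    with 2 show ?thesis
      using infinite_primitive_triples_double_square by simp
  qed
qed

end
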